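(* Let $\psi$ be an Orlicz function. Consider the nonparametric regression model $Y_i=\mu_i+\epsilon_i$, $i=1,\ldots,n$, where $(\epsilon_i)_{i\ge1}$ are i.i.d. centered real-valued error terms distributed as $\epsilon$, and $\mu=(\mu_i)_{i=1}^n$ is a deterministic real signal which may depend on $n$ (for instance $\mu_i=f(i/n)$ for a function $f:[0,1]\to\mathbb{R}$). For $r>0$ let $$\mathcal{E}_n(\mu,r)=\sum_{i=2}^n \mathbf{1}\big(|\mu_i-\mu_{i-1}|>r\big).$$ Suppose that $\|\epsilon\|_\psi<\infty$ and that there is a function $\mathcal{E}^*:(0,\infty)\to[0,\infty)$ such that $$\limsup_{n\to\infty}\mathcal{E}_n(\mu,r)\le\mathcal{E}^*(r)\ \text{ for all } r>0,\qquad \mathcal{E}^*(r)\to0\ \text{ as } r\to\infty .$$ Then the difference-based estimator $$\widehat\sigma_{\psi,\mathrm{NP}}=\inf\Big\{\sigma>0 : \frac{1}{n-1}\sum_{i=2}^n\psi\Big(\frac{|Y_i-Y_{i-1}|}{\sigma}\Big)\le1\Big\}$$ satisfies $\widehat\sigma_{\psi,\mathrm{NP}}\to\|\epsilon_2-\epsilon_1\|_\psi$ almost surely as $n\to\infty$.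
   Context: An Orlicz function is a function $\psi:[0,\infty)\to[0,\infty)$ that is increasing and convex, with $\psi(0)=0$ and $\psi(x)\to\infty$ as $x\to\infty$. For a real random variable $X$, the Orlicz norm is $\|X\|_\psi=\inf\{\sigma>0 : \mathbb{E}\,\psi(|X|/\sigma)\le 1\}$ (with $\inf\emptyset=\infty$). *)

theory Defs
  imports "HOL-Probability.Probability"
begin

text \<open>
  An Orlicz function has domain \<open>[0,\<infinity>)\<close>; it is represented by a function on the reals whose
  values at negative arguments are irrelevant. Increasing is read in the non-strict sense.
\<close>

definition orlicz_function :: "(real \<Rightarrow> real) \<Rightarrow> bool" where
  "orlicz_function \<psi> \<longleftrightarrow>
     (\<forall>x\<ge>0. 0 \<le> \<psi> x) \<and> mono_on {0..} \<psi> \<and> convex_on {0..} \<psi> \<and> \<psi> 0 = 0 \<and>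
     filterlim \<psi> at_top at_top"

text \<open>
  The infimum is taken in \<open>[0,\<infinity>]\<close>, so that the infimum of the empty set is \<open>\<infinity>\<close>. The
  expectation is the integral of a nonnegative function and may be infinite.
\<close>

definition orlicz_norm :: "'a measure \<Rightarrow> (real \<Rightarrow> real) \<Rightarrow> ('a \<Rightarrow> real) \<Rightarrow> ennreal" where
  "orlicz_norm M \<psi> X =
     Inf {ennreal \<sigma> | \<sigma>. \<sigma> > 0 \<and> (\<integral>\<^sup>+ \<omega>. ennreal (\<psi> (\<bar>X \<omega>\<bar> / \<sigma>)) \<partial>M) \<le> 1}"

definition jump_count :: "nat \<Rightarrow> (nat \<Rightarrow> real) \<Rightarrow> real \<Rightarrow> nat" where
  "jump_count n m r = (\<Sum>i=2..n. if \<bar>m i - m (i - 1)\<bar> > r then 1 else 0)"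

definition diff_estimator :: "(real \<Rightarrow> real) \<Rightarrow> nat \<Rightarrow> (nat \<Rightarrow> real) \<Rightarrow> ennreal" where
  "diff_estimator \<psi> n y =
     Inf {ennreal \<sigma> | \<sigma>. \<sigma> > 0 \<and>
            1 / (real n - 1) * (\<Sum>i=2..n. \<psi> (\<bar>y i - y (i - 1)\<bar> / \<sigma>)) \<le> 1}"

end

theory Submission
  imports Defs
begin

text \<open>
  For \<open>0 < a < b\<close>, convexity of \<open>\<psi>\<close> gives
  \<open>\<psi> ((x + r) / b) \<le> (a/b) \<psi> (x / a) + (1 - a/b) \<psi> (r / (b - a))\<close>. Hence replacing the differences of the
  errors by those of the observations, at the price of an arbitrarily small change of scale, costs
  little at the indices where the signal moves by at most \<open>r\<close>, and a bounded amount at the boundedly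
  many other indices, since the jumps of the signal are eventually uniformly bounded. So the
  estimator behaves like the empirical Orlicz norm of the stationary 1-dependent sequence
  \<open>\<epsilon>\<^sub>i - \<epsilon>\<^sub>i\<^sub>-\<^sub>1\<close>, to which a strong law of large numbers applies at every rational scale. Below the limiting
  scale the expectation may be infinite, and the law is applied to \<open>min \<psi> A\<close>.

  The strong law follows Etemadi: truncating at \<open>\<alpha>\<^sup>m\<close> along the block lengths \<open>\<lceil>\<alpha>\<^sup>m\<rceil>\<close>, both the
  variances of the averages and the truncation probabilities are summable in \<open>m\<close>; monotonicity of the
  partial sums fills the gaps between the blocks, up to a factor \<open>\<alpha>\<close>, and \<open>\<alpha>\<close> tends to \<open>1\<close>.
\<close>

section \<open>A strong law of large numbers\<close>

text \<open>
  For \<open>z \<ge> 0\<close> truncated at level \<open>u\<close>, the first branch accounts for the second moment and the second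
  one for the event of truncation.
\<close>

definition quad_lin :: "real \<Rightarrow> real \<Rightarrow> real" where
  "quad_lin z u = (if z \<le> u then z\<^sup>2 / u else u)"

lemma quad_lin_nonneg: "0 < u \<Longrightarrow> 0 \<le> quad_lin z u"
  by (simp add: quad_lin_def)

lemma borel_measurable_quad_lin [measurable]: "(\<lambda>z. quad_lin z u) \<in> borel_measurable borel"
  unfolding quad_lin_def by measurable

lemma sum_quad_lin_power_le:
  fixes \<alpha> z :: real
  assumes "1 < \<alpha>" "0 \<le> z"
  shows "(\<Sum>m<N. quad_lin z (\<alpha> ^ m)) \<le> 2 * \<alpha> / (\<alpha> - 1) * z"
proof -
  \<comment> \<open>\<open>\<Phi>\<close> integrates \<open>min 1 (z\<^sup>2 / u\<^sup>2)\<close>, so its increments over \<open>[u, \<alpha> u]\<close> dominate the summands and telescope.\<close>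
  define \<Phi> where "\<Phi> u = (if z \<le> u then 2 * z - z\<^sup>2 / u else u)" for u
  \<comment> \<open>\<open>c\<close> is the exact ratio between the summand and the increment of
    \<open>\<Phi>\<close> over \<open>[u, \<alpha> * u]\<close> when \<open>z \<le> u\<close>. In
    the two remaining positions of \<open>z\<close> the same constant suffices as an upper
    bound.\<close>
  define c where "c = \<alpha> / (\<alpha> - 1)"
  have c: "0 \<le> c" "c * (\<alpha> - 1) = \<alpha>" using assms by (auto simp: c_def)
  have step: "quad_lin z u \<le> c * (\<Phi> (\<alpha> * u) - \<Phi> u)" if u: "0 < u" for u
  proof -
    have "(\<alpha> - 1) * quad_lin z u \<le> \<alpha> * (\<Phi> (\<alpha> * u) - \<Phi> u)"
    proof (cases "z \<le> u")
      case True
      moreover have "u \<le> \<alpha> * u" using assms u by simp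
      ultimately have "\<Phi> (\<alpha> * u) - \<Phi> u = z\<^sup>2 / u - z\<^sup>2 / (\<alpha> * u)"
        using True by (simp add: \<Phi>_def)
      then have "\<alpha> * (\<Phi> (\<alpha> * u) - \<Phi> u) = \<alpha> * (z\<^sup>2 / u - z\<^sup>2 / (\<alpha> * u))"
        by simp
      also have "\<dots> = (\<alpha> - 1) * (z\<^sup>2 / u)"
        using u assms by (simp add: field_simps)
      also have "z\<^sup>2 / u = quad_lin z u" using True by (simp add: quad_lin_def)
      finally show ?thesis by simp
    next
      case False
      show ?thesis
      proof (cases "z \<le> \<alpha> * u")
        case True
        \<comment> \<open>This product is the claimed inequality for
          \<open>u < z \<le> \<alpha> * u\<close>, cleared of the denominator \<open>u\<close> and
          factored.\<close>
        have "0 \<le> (z - u) * (2 * \<alpha> * u - z - u)"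
        proof (intro mult_nonneg_nonneg)
          have "u \<le> \<alpha> * u" using assms u by simp
          then show "0 \<le> 2 * \<alpha> * u - z - u" using True by linarith
        qed (use False in simp)
        then have "(\<alpha> - 1) * u * u \<le> (\<alpha> * (2 * z - u)) * u - z\<^sup>2"
          by (simp add: algebra_simps power2_eq_square)
        then have "(\<alpha> - 1) * u \<le> \<alpha> * (2 * z - u) - z\<^sup>2 / u"
          using u by (simp add: field_simps)
        moreover have "\<alpha> * (\<Phi> (\<alpha> * u) - \<Phi> u) = \<alpha> * (2 * z - u) - z\<^sup>2 / u"
          using True False assms u by (simp add: \<Phi>_def field_simps)
        ultimately show ?thesis using False by (simp add: quad_lin_def)
      next
        case False2: False
        have "(\<alpha> - 1) * u \<le> \<alpha> * ((\<alpha> - 1) * u)"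
          using assms u by simp
        then show ?thesis
          using False2 False assms u by (simp add: \<Phi>_def quad_lin_def algebra_simps)
      qed
    qed
    then show ?thesis using assms by (simp add: c_def field_simps)
  qed
  have "(\<Sum>m<N. quad_lin z (\<alpha> ^ m)) \<le> (\<Sum>m<N. c * (\<Phi> (\<alpha> ^ Suc m) - \<Phi> (\<alpha> ^ m)))"
    using assms step[of "\<alpha> ^ _"] by (intro sum_mono) simp
  also have "\<dots> = c * (\<Phi> (\<alpha> ^ N) - \<Phi> 1)"
    unfolding sum_distrib_left[symmetric] by (subst sum_lessThan_telescope) simp
  also have "\<dots> \<le> c * (2 * z)"
  proof (intro mult_left_mono c)
    have "\<Phi> (\<alpha> ^ N) \<le> 2 * z" using assms by (auto simp: \<Phi>_def)
    moreover have "0 \<le> \<Phi> 1"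
    proof (cases "z \<le> 1")
      case True
      then have "z * z \<le> 1 * z" using assms by (intro mult_right_mono)
      then show ?thesis using True assms by (simp add: \<Phi>_def power2_eq_square)
    qed (simp add: \<Phi>_def)
    ultimately show "\<Phi> (\<alpha> ^ N) - \<Phi> 1 \<le> 2 * z" by simp
  qed
  finally show ?thesis by (simp add: c_def mult_ac)
qed

lemma suminf_quad_lin_power_le:
  fixes \<alpha> z :: real
  assumes "1 < \<alpha>" "0 \<le> z"
  shows "(\<Sum>m. ennreal (quad_lin z (\<alpha> ^ m))) \<le> ennreal (2 * \<alpha> / (\<alpha> - 1) * z)"
proof (rule suminf_le_const[OF summableI])
  fix N
  show "(\<Sum>m<N. ennreal (quad_lin z (\<alpha> ^ m))) \<le> ennreal (2 * \<alpha> / (\<alpha> - 1) * z)"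
    using assms sum_quad_lin_power_le[OF assms] 
    by (subst sum_ennreal) (auto intro!: ennreal_leI quad_lin_nonneg)
qed

text \<open>Partial sums of nonnegative terms increase. So if \<open>n\<close> lies between
  consecutive block lengths \<open>k p\<close> and \<open>k (Suc p)\<close>, its average is squeezed
  between \<open>S (k p) / k (Suc p)\<close> and \<open>S (k (Suc p)) / k p\<close>, which tend to
  \<open>L / \<alpha>\<close> and \<open>L * \<alpha>\<close>. Letting \<open>\<alpha>\<close>
  decrease to 1 closes the gap. The ratios form a sequence so that the hypothesis remains a
  countable family of conditions.\<close>

lemma averages_tendsto_geometric:
  fixes a :: "nat \<Rightarrow> real"
  assumes nonneg: "\<And>i. 0 \<le> a i"
    and conv: "\<And>j. (\<lambda>m. (\<Sum>i<nat \<lceil>(1 + 1 / real (Suc j)) ^ m\<rceil>. a i) /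
                 real (nat \<lceil>(1 + 1 / real (Suc j)) ^ m\<rceil>)) \<longlonglongrightarrow> L"
  shows "(\<lambda>n. (\<Sum>i<n. a i) / real n) \<longlonglongrightarrow> L"
proof -
  define S where "S n = (\<Sum>i<n. a i)" for n
  have S_mono: "S i \<le> S j" if "i \<le> j" for i j
    unfolding S_def using that by (intro sum_mono2) (auto simp: nonneg)
  have S_nonneg: "0 \<le> S i" for i by (simp add: S_def nonneg sum_nonneg)
  have ev: "(\<forall>\<^sub>F n in sequentially. b < S n / real n) \<and> (\<forall>\<^sub>F n in sequentially. S n / real n < c)"
    if \<alpha>: "\<alpha> = 1 + 1 / real (Suc j)" and b: "b < L / \<alpha>" and c: "L * \<alpha> < c" for \<alpha> j b c
  proof -
    have "1 < \<alpha>" by (simp add: \<alpha>)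
    define k where "k m = nat \<lceil>\<alpha> ^ m\<rceil>" for m
    have k_bounds: "\<alpha> ^ m \<le> real (k m)" "real (k m) \<le> \<alpha> ^ m + 1" for m
      using \<open>1 < \<alpha>\<close> by (auto simp: k_def intro: order.trans[OF zero_le_power])
    have k_pos: "0 < real (k m)" for m
      using k_bounds(1)[of m] \<open>1 < \<alpha>\<close> by (smt (verit) zero_less_power)
    have k_lim: "(\<lambda>m. S (k m) / k m) \<longlonglongrightarrow> L"
      using conv[of j] by (simp add: S_def k_def \<alpha>)
    have ratio: "(\<lambda>m. k (Suc m) / k m) \<longlonglongrightarrow> \<alpha>"
    proof (rule tendsto_sandwich)
      show "\<forall>\<^sub>F m in sequentially. \<alpha> ^ Suc m / (\<alpha> ^ m + 1) \<le> k (Suc m) / k m"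
        using k_bounds k_pos \<open>1 < \<alpha>\<close>
        by (intro always_eventually allI frac_le) (auto simp del: power_Suc)
      show "\<forall>\<^sub>F m in sequentially. k (Suc m) / k m \<le> (\<alpha> ^ Suc m + 1) / \<alpha> ^ m"
        using k_bounds k_pos \<open>1 < \<alpha>\<close>
        by (intro always_eventually allI frac_le) (auto simp del: power_Suc)
      have 0: "(\<lambda>m. (1 / \<alpha>) ^ m) \<longlonglongrightarrow> 0"
        using \<open>1 < \<alpha>\<close> by (intro LIMSEQ_power_zero) auto
      have "(\<lambda>m. \<alpha> / (1 + (1 / \<alpha>) ^ m)) \<longlonglongrightarrow> \<alpha> / (1 + 0)"
        by (intro tendsto_intros 0) auto
      moreover have "\<alpha> / (1 + (1 / \<alpha>) ^ m) = \<alpha> ^ Suc m / (\<alpha> ^ m + 1)" for m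
      proof -
        have "\<alpha> / (1 + (1 / \<alpha>) ^ m) = (\<alpha> ^ m * \<alpha>) / (\<alpha> ^ m * (1 + (1 / \<alpha>) ^ m))"
          using \<open>1 < \<alpha>\<close> by (subst mult_divide_mult_cancel_left) auto
        also have "\<alpha> ^ m * (1 + (1 / \<alpha>) ^ m) = \<alpha> ^ m + 1"
          using \<open>1 < \<alpha>\<close> by (simp add: distrib_left power_one_over)
        finally show ?thesis by (simp add: mult.commute)
      qed
      ultimately show "(\<lambda>m. \<alpha> ^ Suc m / (\<alpha> ^ m + 1)) \<longlonglongrightarrow> \<alpha>" by simp
      have "(\<lambda>m. \<alpha> + (1 / \<alpha>) ^ m) \<longlonglongrightarrow> \<alpha> + 0"
        by (intro tendsto_intros 0)
      moreover have "\<alpha> + (1 / \<alpha>) ^ m = (\<alpha> ^ Suc m + 1) / \<alpha> ^ m" for m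
        using \<open>1 < \<alpha>\<close> by (simp add: power_one_over field_simps)
      ultimately show "(\<lambda>m. (\<alpha> ^ Suc m + 1) / \<alpha> ^ m) \<longlonglongrightarrow> \<alpha>" by simp
    qed
    \<comment> \<open>\<open>p n\<close> is the index of the block that contains \<open>n\<close>:
      the floor gives \<open>\<alpha> ^ p n \<le> n \<le> \<alpha> ^ Suc (p n)\<close>, and rounding
      \<open>\<alpha> ^ p n\<close> up to \<open>k (p n)\<close> keeps the first inequality because
      \<open>n\<close> is an integer.\<close>
    define p where "p n = nat \<lfloor>log \<alpha> (real n)\<rfloor>" for n
    have p_top: "filterlim p sequentially sequentially"
      unfolding p_def using \<open>1 < \<alpha>\<close>
      by (intro filterlim_compose[OF filterlim_nat_sequentially]
           filterlim_compose[OF filterlim_floor_sequentially]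
           filterlim_compose[OF _ filterlim_real_sequentially]) real_asymp
    have p: "k (p n) \<le> n" "n \<le> k (Suc (p n))" if "1 \<le> n" for n
    proof -
      have l: "0 \<le> log \<alpha> n" using that \<open>1 < \<alpha>\<close> by simp
      have "\<alpha> ^ p n = \<alpha> powr (real (p n))" using \<open>1 < \<alpha>\<close> by (simp add: powr_realpow)
      also have "\<dots> \<le> \<alpha> powr (log \<alpha> n)"
        using l \<open>1 < \<alpha>\<close> by (intro powr_mono) (auto simp: p_def)
      also have "\<dots> = n" using that \<open>1 < \<alpha>\<close> by simp
      finally show "k (p n) \<le> n" by (simp add: k_def ceiling_le_iff nat_le_iff)
      have "real n = \<alpha> powr (log \<alpha> n)" using that \<open>1 < \<alpha>\<close> by simp
      also have "\<dots> \<le> \<alpha> powr (real (Suc (p n)))"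
        using l \<open>1 < \<alpha>\<close> by (intro powr_mono) (auto simp: p_def, linarith)
      also have "\<dots> = \<alpha> ^ Suc (p n)" using \<open>1 < \<alpha>\<close> by (subst powr_realpow) auto
      also have "\<dots> \<le> k (Suc (p n))" by (rule k_bounds)
      finally show "n \<le> k (Suc (p n))" by simp
    qed
    have "(\<lambda>m. S (k m) / k m / (k (Suc m) / k m)) \<longlonglongrightarrow> L / \<alpha>"
      using \<open>1 < \<alpha>\<close> by (intro tendsto_intros k_lim ratio) auto
    from filterlim_compose[OF this p_top] b
    have "\<forall>\<^sub>F n in sequentially. b < S (k (p n)) / k (p n) / (k (Suc (p n)) / k (p n))"
      by (simp add: order_tendsto_iff)
    then have lower: "\<forall>\<^sub>F n in sequentially. b < S n / n"
      using eventually_ge_at_top[of 1]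
    proof eventually_elim
      case (elim n)
      have "S (k (p n)) / k (p n) / (k (Suc (p n)) / k (p n)) = S (k (p n)) / k (Suc (p n))"
        using k_pos[of "p n"] by simp
      also have "\<dots> \<le> S n / n"
        using elim p[of n] by (intro frac_le S_mono S_nonneg) auto
      finally show ?case using elim by simp
    qed
    have "(\<lambda>m. S (k (Suc m)) / k (Suc m) * (k (Suc m) / k m)) \<longlonglongrightarrow> L * \<alpha>"
      by (intro tendsto_intros ratio LIMSEQ_Suc[OF k_lim])
    from filterlim_compose[OF this p_top] c
    have "\<forall>\<^sub>F n in sequentially. S (k (Suc (p n))) / k (Suc (p n)) * (k (Suc (p n)) / k (p n)) < c"
      by (simp add: order_tendsto_iff)
    then have "\<forall>\<^sub>F n in sequentially. S n / n < c"
      using eventually_ge_at_top[of 1]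
    proof eventually_elim
      case (elim n)
      have "S n / n \<le> S (k (Suc (p n))) / k (p n)"
        using elim p[of n] k_pos[of "p n"] by (intro frac_le S_mono S_nonneg) auto
      also have "\<dots> = S (k (Suc (p n))) / k (Suc (p n)) * (k (Suc (p n)) / k (p n))"
        using k_pos[of "Suc (p n)"] by simp
      finally show ?case using elim by simp
    qed
    with lower show ?thesis ..
  qed
  have \<alpha>_lim: "(\<lambda>j. 1 + 1 / real (Suc j)) \<longlonglongrightarrow> 1"
    by real_asymp
  have "(\<lambda>n. S n / real n) \<longlonglongrightarrow> L"
  proof (rule order_tendstoI)
    fix b assume "b < L"
    have "(\<lambda>j. L / (1 + 1 / real (Suc j))) \<longlonglongrightarrow> L"
      using tendsto_divide[OF tendsto_const[of L] \<alpha>_lim] by simp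
    then have "\<forall>\<^sub>F j in sequentially. b < L / (1 + 1 / real (Suc j))"
      using \<open>b < L\<close> by (rule order_tendstoD)
    then obtain j where "b < L / (1 + 1 / real (Suc j))"
      using eventually_happens'[OF sequentially_bot] by blast
    \<comment> \<open>The upper threshold is a dummy value that meets the premise of
      \<open>ev\<close>; the half wanted here is the lower one.\<close>
    from ev[OF refl this, of "L * (1 + 1 / real (Suc j)) + 1"]
    show "\<forall>\<^sub>F n in sequentially. b < S n / real n" by simp
  next
    fix c assume "L < c"
    have "(\<lambda>j. L * (1 + 1 / real (Suc j))) \<longlonglongrightarrow> L"
      using tendsto_mult[OF tendsto_const[of L] \<alpha>_lim] by simp
    then have "\<forall>\<^sub>F j in sequentially. L * (1 + 1 / real (Suc j)) < c"
      using \<open>L < c\<close> by (rule order_tendstoD)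
    then obtain j where "L * (1 + 1 / real (Suc j)) < c"
      using eventually_happens'[OF sequentially_bot] by blast
    from ev[OF refl _ this, of "L / (1 + 1 / real (Suc j)) - 1"]
    show "\<forall>\<^sub>F n in sequentially. S n / real n < c" by simp
  qed
  then show ?thesis by (simp add: S_def)
qed

text \<open>Expand the square. Pairs of indices at distance at least \<open>d\<close> contribute
  zero, by independence and centering. Each of the at most \<open>2 * d\<close> remaining partners
  of an index contributes at most \<open>v\<close>, because a product is bounded by the mean of the
  two squares.\<close>

lemma (in prob_space) gap_independent_second_moment_le:
  fixes X :: "nat \<Rightarrow> 'a \<Rightarrow> real"
  assumes X [measurable]: "\<And>i. random_variable borel (X i)"
    and sq: "\<And>i. integrable M (\<lambda>\<omega>. (X i \<omega>)\<^sup>2)"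
    and centered: "\<And>i. expectation (X i) = 0"
    and v: "\<And>i. expectation (\<lambda>\<omega>. (X i \<omega>)\<^sup>2) \<le> v"
    and indep: "\<And>i j. i + d \<le> j \<Longrightarrow> indep_var borel (X i) borel (X j)"
  shows "integrable M (\<lambda>\<omega>. (\<Sum>i<k. X i \<omega>)\<^sup>2)"
    and "expectation (\<lambda>\<omega>. (\<Sum>i<k. X i \<omega>)\<^sup>2) \<le> 2 * real d * real k * v"
proof -
  have "0 \<le> v" using v[of 0] by (rule order.trans[rotated]) simp
  have amgm: "\<bar>x * y\<bar> \<le> (x\<^sup>2 + y\<^sup>2) / 2" for x y :: real
    using zero_le_power2[of "\<bar>x\<bar> - \<bar>y\<bar>"] by (simp add: power2_diff abs_mult)
  have int: "integrable M (X i)" for i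
    by (rule square_integrable_imp_integrable[OF X sq])
  have prod_int: "integrable M (\<lambda>\<omega>. X i \<omega> * X j \<omega>)" for i j
  proof (rule Bochner_Integration.integrable_bound)
    show "integrable M (\<lambda>\<omega>. ((X i \<omega>)\<^sup>2 + (X j \<omega>)\<^sup>2) / 2)" using sq by simp
    show "AE \<omega> in M. norm (X i \<omega> * X j \<omega>) \<le> norm (((X i \<omega>)\<^sup>2 + (X j \<omega>)\<^sup>2) / 2)"
      using amgm by (intro always_eventually allI) (metis real_norm_def order.trans abs_ge_self)
  qed simp
  have eq: "(\<lambda>\<omega>. (\<Sum>i<k. X i \<omega>)\<^sup>2) = (\<lambda>\<omega>. \<Sum>i<k. \<Sum>j<k. X i \<omega> * X j \<omega>)"
    by (simp add: power2_eq_square sum_product)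
  show "integrable M (\<lambda>\<omega>. (\<Sum>i<k. X i \<omega>)\<^sup>2)"
    unfolding eq by (intro Bochner_Integration.integrable_sum prod_int)
  have far: "expectation (\<lambda>\<omega>. X i \<omega> * X j \<omega>) = 0" if "i + d \<le> j \<or> j + d \<le> i" for i j
    using that
  proof
    assume "i + d \<le> j"
    from indep_var_lebesgue_integral[OF indep[OF this] int int] show ?thesis
      by (simp add: centered)
  next
    assume "j + d \<le> i"
    from indep_var_lebesgue_integral[OF indep[OF this] int int] show ?thesis
      by (simp add: centered mult.commute)
  qed
  have near: "expectation (\<lambda>\<omega>. X i \<omega> * X j \<omega>) \<le> v" for i j
  proof -
    have "expectation (\<lambda>\<omega>. X i \<omega> * X j \<omega>) \<le> expectation (\<lambda>\<omega>. ((X i \<omega>)\<^sup>2 + (X j \<omega>)\<^sup>2) / 2)"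
      using order.trans[OF abs_ge_self amgm] sq by (intro integral_mono prod_int) simp_all
    also have "\<dots> \<le> v" using v[of i] v[of j] sq by simp
    finally show ?thesis .
  qed
  have "expectation (\<lambda>\<omega>. (\<Sum>i<k. X i \<omega>)\<^sup>2) = (\<Sum>i<k. \<Sum>j<k. expectation (\<lambda>\<omega>. X i \<omega> * X j \<omega>))"
    unfolding eq by (simp add: prod_int)
  also have "\<dots> \<le> (\<Sum>i<k. 2 * real d * v)"
  proof (intro sum_mono)
    fix i
    \<comment> \<open>The half-open window contains every \<open>j\<close> at distance less than
      \<open>d\<close> from \<open>i\<close> and has at most \<open>2 * d\<close> elements;
      subtraction truncated at zero only shortens it.\<close>
    have "(\<Sum>j<k. expectation (\<lambda>\<omega>. X i \<omega> * X j \<omega>)) \<le> (\<Sum>j<k. if j \<in> {i - d..<i + d} then v else 0)"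
    proof (intro sum_mono)
      fix j
      show "expectation (\<lambda>\<omega>. X i \<omega> * X j \<omega>) \<le> (if j \<in> {i - d..<i + d} then v else 0)"
      proof (cases "j \<in> {i - d..<i + d}")
        case False
        then have "i + d \<le> j \<or> j + d \<le> i" unfolding atLeastLessThan_iff by linarith
        then show ?thesis by (simp add: far \<open>0 \<le> v\<close>)
      qed (simp add: near)
    qed
    also have "\<dots> = real (card ({..<k} \<inter> {i - d..<i + d})) * v"
      by (simp add: sum.If_cases del: atLeastLessThan_iff)
    also have "\<dots> \<le> real (2 * d) * v"
    proof (intro mult_right_mono \<open>0 \<le> v\<close>)
      have "card ({..<k} \<inter> {i - d..<i + d}) \<le> card {i - d..<i + d}"
        by (intro card_mono) auto
      then show "real (card ({..<k} \<inter> {i - d..<i + d})) \<le> real (2 * d)" by simp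
    qed
    finally show "(\<Sum>j<k. expectation (\<lambda>\<omega>. X i \<omega> * X j \<omega>)) \<le> 2 * real d * v" by simp
  qed
  finally show "expectation (\<lambda>\<omega>. (\<Sum>i<k. X i \<omega>)\<^sup>2) \<le> 2 * real d * real k * v"
    by (simp add: algebra_simps)
qed

text \<open>\<open>Q m\<close> adds the squared average of the centered truncated variables in block
  \<open>m\<close> to the number \<open>J m\<close> of variables exceeding the truncation level. Its
  expectation is at most a constant times that of \<open>quad_lin (Z 0 \<omega>) (u m)\<close>,
  hence summable in \<open>m\<close>, so \<open>Q m\<close> tends to 0 almost surely. The first
  summand then controls the truncated averages, and the second shows that truncation eventually
  changes nothing.\<close>

lemma (in prob_space) AE_geometric_averages_tendsto:
  fixes Z :: "nat \<Rightarrow> 'a \<Rightarrow> real" and \<alpha> :: real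
  assumes Z [measurable]: "\<And>i. random_variable borel (Z i)"
    and nonneg: "\<And>i \<omega>. 0 \<le> Z i \<omega>"
    and ident: "\<And>i. distr M borel (Z i) = distr M borel (Z 0)"
    and int: "integrable M (Z 0)"
    and indep: "\<And>i j. i + d \<le> j \<Longrightarrow> indep_var borel (Z i) borel (Z j)"
    and \<alpha>: "1 < \<alpha>"
  shows "AE \<omega> in M. (\<lambda>m. (\<Sum>i<nat \<lceil>\<alpha> ^ m\<rceil>. Z i \<omega>) / real (nat \<lceil>\<alpha> ^ m\<rceil>)) \<longlonglongrightarrow> expectation (Z 0)"
proof -
  define u where "u m = \<alpha> ^ m" for m
  define k where "k m = nat \<lceil>u m\<rceil>" for m
  have u: "1 \<le> u m" for m using \<alpha> by (simp add: u_def)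
  have k: "u m \<le> real (k m)" "real (k m) \<le> 2 * u m" "0 < real (k m)" for m
  proof -
    show "u m \<le> real (k m)" unfolding k_def by (rule real_nat_ceiling_ge)
    then show "0 < real (k m)" using u[of m] by linarith
    show "real (k m) \<le> 2 * u m" using u[of m] unfolding k_def by linarith
  qed
  define trunc where "trunc m z = (if z \<le> u m then z else 0)" for m and z :: real
  have trunc_m [measurable]: "trunc m \<in> borel_measurable borel" for m
    unfolding trunc_def by measurable
  define e where "e m = expectation (\<lambda>\<omega>. trunc m (Z 0 \<omega>))" for m
  define v where "v m = expectation (\<lambda>\<omega>. (trunc m (Z 0 \<omega>))\<^sup>2)" for m
  define p where "p m = expectation (\<lambda>\<omega>. if u m < Z 0 \<omega> then 1 else 0 :: real)" for m
  define X where "X m i \<omega> = trunc m (Z i \<omega>) - e m" for m i \<omega>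
  define J where "J m \<omega> = (\<Sum>i<k m. if u m < Z i \<omega> then 1 else 0 :: real)" for m \<omega>
  define Q where "Q m \<omega> = ((\<Sum>i<k m. X m i \<omega>) / k m)\<^sup>2 + J m \<omega>" for m \<omega>
  have X_m [measurable]: "random_variable borel (X m i)" for m i
    unfolding X_def by measurable
  have Q_m [measurable]: "random_variable borel (Q m)" for m
    unfolding Q_def J_def by measurable
  have transfer: "expectation (\<lambda>\<omega>. g (Z i \<omega>)) = expectation (\<lambda>\<omega>. g (Z 0 \<omega>))"
    if [measurable]: "g \<in> borel_measurable borel" for g :: "real \<Rightarrow> real" and i
  proof -
    have "expectation (\<lambda>\<omega>. g (Z i \<omega>)) = integral\<^sup>L (distr M borel (Z i)) g"
      by (simp add: integral_distr)
    also have "\<dots> = expectation (\<lambda>\<omega>. g (Z 0 \<omega>))"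
      by (subst ident) (simp add: integral_distr)
    finally show ?thesis .
  qed
  have trunc_bound: "0 \<le> trunc m (Z i \<omega>)" "trunc m (Z i \<omega>) \<le> u m" for m i \<omega>
    using nonneg[of i \<omega>] u[of m] by (auto simp: trunc_def)
  have trunc_int: "integrable M (\<lambda>\<omega>. trunc m (Z i \<omega>))" for m i
    by (rule integrable_const_bound[where B = "u m"]) (use trunc_bound in auto)
  have trunc_sq_int: "integrable M (\<lambda>\<omega>. (trunc m (Z i \<omega>))\<^sup>2)" for m i
    by (rule integrable_const_bound[where B = "(u m)\<^sup>2"]) (use trunc_bound in \<open>auto intro!: power_mono\<close>)
  have ind_int: "integrable M (\<lambda>\<omega>. if u m < Z i \<omega> then 1 else 0 :: real)" for m i
    by (rule integrable_const_bound[where B = 1]) auto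
  have X_mean: "expectation (X m i) = 0" for m i
    using trunc_int[of m i] transfer[of "trunc m" i] by (simp add: X_def [abs_def] e_def prob_space)
  have X_sq_int: "integrable M (\<lambda>\<omega>. (X m i \<omega>)\<^sup>2)" for m i
    unfolding X_def power2_diff using trunc_int[of m i] trunc_sq_int[of m i] by simp
  have X_sq: "expectation (\<lambda>\<omega>. (X m i \<omega>)\<^sup>2) \<le> v m" for m i
  proof -
    have "expectation (\<lambda>\<omega>. (X m i \<omega>)\<^sup>2) = variance (\<lambda>\<omega>. trunc m (Z i \<omega>))"
      using transfer[of "trunc m" i] by (simp add: X_def e_def)
    also have "\<dots> \<le> expectation (\<lambda>\<omega>. (trunc m (Z i \<omega>))\<^sup>2)"
      by (subst variance_eq[OF trunc_int trunc_sq_int]) simp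
    also have "\<dots> = v m"
      unfolding v_def by (rule transfer) measurable
    finally show ?thesis .
  qed
  have X_indep: "indep_var borel (X m i) borel (X m j)" if "i + d \<le> j" for m i j
  proof -
    have "(\<lambda>z. trunc m z - e m) \<in> borel_measurable borel" by measurable
    from indep_var_compose[OF indep[OF that] this this] show ?thesis
      by (simp add: X_def [abs_def] comp_def)
  qed
  have X_sum: "integrable M (\<lambda>\<omega>. (\<Sum>i<k m. X m i \<omega>)\<^sup>2)"
    "expectation (\<lambda>\<omega>. (\<Sum>i<k m. X m i \<omega>)\<^sup>2) \<le> 2 * real d * real (k m) * v m" for m
    by (rule gap_independent_second_moment_le[of "X m" "v m" d] X_m X_sq_int X_mean X_sq X_indep; assumption?)+
  have J_int: "integrable M (J m)" for m
    unfolding J_def by (intro Bochner_Integration.integrable_sum ind_int)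
  have Q_int: "integrable M (Q m)" for m
    unfolding Q_def power_divide using X_sum(1)[of m] J_int by simp
  have ql_eq: "quad_lin (Z 0 \<omega>) (u m) = (trunc m (Z 0 \<omega>))\<^sup>2 / u m + u m * (if u m < Z 0 \<omega> then 1 else 0)" for m \<omega>
    by (simp add: quad_lin_def trunc_def)
  have ql_int: "integrable M (\<lambda>\<omega>. quad_lin (Z 0 \<omega>) (u m))" for m
    unfolding ql_eq using trunc_sq_int ind_int by simp
  \<comment> \<open>The term \<open>2 * real d\<close> comes from the second moment bound and
    \<open>2\<close> from \<open>k m \<le> 2 * u m\<close>; the sum dominates both
    coefficients.\<close>
  define c where "c = 2 * real d + 2"
  have c: "0 \<le> c" by (simp add: c_def)
  have Q_le: "expectation (Q m) \<le> c * expectation (\<lambda>\<omega>. quad_lin (Z 0 \<omega>) (u m))" for m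
  proof -
    have vp: "0 \<le> v m" "0 \<le> p m" unfolding v_def p_def by simp_all
    have ind: "expectation (\<lambda>\<omega>. if u m < Z i \<omega> then 1 else 0) = p m" for i
      unfolding p_def by (rule transfer [of "\<lambda>z. if u m < z then 1 else 0"]) measurable
    have "expectation (J m) = (\<Sum>i<k m. expectation (\<lambda>\<omega>. if u m < Z i \<omega> then 1 else 0))"
      unfolding J_def by (intro Bochner_Integration.integral_sum ind_int)
    also have "\<dots> = real (k m) * p m"
      by (simp add: ind)
    also have "\<dots> \<le> 2 * u m * p m"
      using k vp by (intro mult_right_mono)
    finally have J_le: "expectation (J m) \<le> 2 * u m * p m" .
    have "expectation (\<lambda>\<omega>. ((\<Sum>i<k m. X m i \<omega>) / k m)\<^sup>2) \<le> 2 * real d * real (k m) * v m / (real (k m))\<^sup>2"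
      unfolding power_divide using X_sum(2)[of m] by (simp add: divide_right_mono)
    also have "\<dots> = 2 * real d * v m / k m"
      using k[of m] by (simp add: power2_eq_square)
    also have "\<dots> \<le> 2 * real d * v m / u m"
      using k[of m] u[of m] vp by (intro divide_left_mono) auto
    finally have "expectation (Q m) \<le> 2 * real d * (v m / u m) + 2 * (u m * p m)"
      unfolding Q_def using J_le J_int X_sum(1)[of m] by (simp add: power_divide)
    also have "\<dots> \<le> c * (v m / u m) + c * (u m * p m)"
      using vp u[of m] by (intro add_mono mult_right_mono) (auto simp: c_def)
    also have "\<dots> = c * expectation (\<lambda>\<omega>. quad_lin (Z 0 \<omega>) (u m))"
      unfolding ql_eq using trunc_sq_int ind_int by (simp add: v_def p_def distrib_left)
    finally show ?thesis .
  qed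
  have Q_nonneg: "0 \<le> Q m \<omega>" for m \<omega>
    by (auto simp: Q_def J_def intro!: add_nonneg_nonneg sum_nonneg)
  have ql_nonneg: "0 \<le> quad_lin z (u m)" for z m
    using u[of m] by (intro quad_lin_nonneg) simp
  have "(\<integral>\<^sup>+\<omega>. (\<Sum>m. ennreal (Q m \<omega>)) \<partial>M) = (\<Sum>m. \<integral>\<^sup>+\<omega>. ennreal (Q m \<omega>) \<partial>M)"
    by (rule nn_integral_suminf) measurable
  also have "\<dots> \<le> (\<Sum>m. ennreal c * (\<integral>\<^sup>+\<omega>. ennreal (quad_lin (Z 0 \<omega>) (u m)) \<partial>M))"
  proof (intro suminf_le summableI)
    fix m
    show "(\<integral>\<^sup>+\<omega>. ennreal (Q m \<omega>) \<partial>M) \<le> ennreal c * (\<integral>\<^sup>+\<omega>. ennreal (quad_lin (Z 0 \<omega>) (u m)) \<partial>M)"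
      using Q_le[of m] Q_int ql_int Q_nonneg ql_nonneg c
      by (simp add: nn_integral_eq_integral ennreal_mult'[symmetric] ennreal_leI)
  qed
  also have "\<dots> = ennreal c * (\<integral>\<^sup>+\<omega>. (\<Sum>m. ennreal (quad_lin (Z 0 \<omega>) (u m))) \<partial>M)"
    by (subst nn_integral_suminf) auto
  also have "\<dots> \<le> ennreal c * (\<integral>\<^sup>+\<omega>. ennreal (2 * \<alpha> / (\<alpha> - 1) * Z 0 \<omega>) \<partial>M)"
    using suminf_quad_lin_power_le[OF \<alpha> nonneg]
    by (intro mult_left_mono nn_integral_mono) (auto simp: u_def)
  also have "\<dots> = ennreal c * ennreal (2 * \<alpha> / (\<alpha> - 1) * expectation (Z 0))"
    using int nonneg \<alpha> by (subst nn_integral_eq_integral) auto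
  also have "\<dots> < \<infinity>" by (simp add: ennreal_mult_less_top)
  finally have "(\<integral>\<^sup>+\<omega>. (\<Sum>m. ennreal (Q m \<omega>)) \<partial>M) \<noteq> \<infinity>" by simp
  then have "AE \<omega> in M. (\<Sum>m. ennreal (Q m \<omega>)) \<noteq> \<infinity>"
    by (intro nn_integral_PInf_AE) auto
  then have AE_Q: "AE \<omega> in M. (\<lambda>m. Q m \<omega>) \<longlonglongrightarrow> 0"
    by eventually_elim (auto intro!: summable_LIMSEQ_zero summable_suminf_not_top Q_nonneg)
  have e_lim: "e \<longlonglongrightarrow> expectation (Z 0)"
    unfolding e_def [abs_def]
  proof (rule integral_dominated_convergence[where w = "Z 0"])
    show "AE \<omega> in M. (\<lambda>m. trunc m (Z 0 \<omega>)) \<longlonglongrightarrow> Z 0 \<omega>"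
    proof (intro AE_I2 tendsto_eventually)
      fix \<omega>
      obtain m\<^sub>0 where "Z 0 \<omega> < \<alpha> ^ m\<^sub>0" using real_arch_pow[OF \<alpha>] by blast
      then have "Z 0 \<omega> \<le> u m" if "m\<^sub>0 \<le> m" for m
        using power_increasing[OF that, of \<alpha>] \<alpha> unfolding u_def by linarith
      then have "\<forall>\<^sub>F m in sequentially. Z 0 \<omega> \<le> u m"
        by (auto simp: eventually_sequentially)
      then show "\<forall>\<^sub>F m in sequentially. trunc m (Z 0 \<omega>) = Z 0 \<omega>"
        by eventually_elim (simp add: trunc_def)
    qed
    show "AE \<omega> in M. norm (trunc m (Z 0 \<omega>)) \<le> Z 0 \<omega>" for m
      using nonneg by (auto simp: trunc_def)
  qed (use int in auto)
  show ?thesis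
    using AE_Q
  proof eventually_elim
    case (elim \<omega>)
    have "(\<lambda>m. ((\<Sum>i<k m. X m i \<omega>) / k m)\<^sup>2) \<longlonglongrightarrow> 0"
      by (rule tendsto_sandwich[OF _ _ tendsto_const elim])
         (auto simp: Q_def J_def intro!: sum_nonneg always_eventually)
    then have "(\<lambda>m. (\<Sum>i<k m. X m i \<omega>) / k m) \<longlonglongrightarrow> 0"
      by (auto dest: tendsto_real_sqrt simp: tendsto_rabs_zero_iff)
    from tendsto_add[OF this e_lim]
    have lim: "(\<lambda>m. (\<Sum>i<k m. X m i \<omega>) / k m + e m) \<longlonglongrightarrow> expectation (Z 0)" by simp
    \<comment> \<open>\<open>J m\<close> is a count, so \<open>Q m \<omega> < 1\<close> leaves no
      index below \<open>k m\<close> with \<open>Z i \<omega>\<close> above \<open>u m\<close>.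
      Adding back \<open>e m\<close> then recovers the average of the original variables.\<close>
    have "\<forall>\<^sub>F m in sequentially. Q m \<omega> < 1"
      using elim by (rule order_tendstoD) simp
    then have "\<forall>\<^sub>F m in sequentially. (\<Sum>i<k m. X m i \<omega>) / k m + e m = (\<Sum>i<k m. Z i \<omega>) / k m"
    proof eventually_elim
      case (elim m)
      have "Z i \<omega> \<le> u m" if "i < k m" for i
      proof (rule ccontr)
        assume "\<not> Z i \<omega> \<le> u m"
        then have "1 = (if u m < Z i \<omega> then 1 else 0 :: real)" by simp
        also have "\<dots> \<le> J m \<omega>"
          unfolding J_def using that by (intro member_le_sum) auto
        also have "\<dots> \<le> Q m \<omega>" by (simp add: Q_def)
        finally show False using elim by simp
      qed
      then have "(\<Sum>i<k m. X m i \<omega>) = (\<Sum>i<k m. Z i \<omega>) - k m * e m"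
        by (simp add: X_def trunc_def sum_subtractf)
      then show ?case using k(3)[of m] by (simp add: field_simps)
    qed
    from Lim_transform_eventually[OF lim this] show ?case by (simp add: k_def u_def)
  qed
qed

text \<open>Only countably many ratios \<open>1 + 1 / real (Suc j)\<close> are involved, so the
  exceptional sets of the block statements unite to a null set, outside which the deterministic
  gap-filling applies.\<close>

theorem (in prob_space) strong_law_gap_independent:
  fixes Z :: "nat \<Rightarrow> 'a \<Rightarrow> real"
  assumes Z: "\<And>i. random_variable borel (Z i)"
    and nonneg: "\<And>i \<omega>. 0 \<le> Z i \<omega>"
    and ident: "\<And>i. distr M borel (Z i) = distr M borel (Z 0)"
    and int: "integrable M (Z 0)"
    and indep: "\<And>i j. i + d \<le> j \<Longrightarrow> indep_var borel (Z i) borel (Z j)"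
  shows "AE \<omega> in M. (\<lambda>n. (\<Sum>i<n. Z i \<omega>) / real n) \<longlonglongrightarrow> expectation (Z 0)"
proof -
  have "AE \<omega> in M. \<forall>j. (\<lambda>m. (\<Sum>i<nat \<lceil>(1 + 1 / real (Suc j)) ^ m\<rceil>. Z i \<omega>) /
      real (nat \<lceil>(1 + 1 / real (Suc j)) ^ m\<rceil>)) \<longlonglongrightarrow> expectation (Z 0)"
    unfolding AE_all_countable
    by (intro allI AE_geometric_averages_tendsto[where d = d] assms) auto
  then show ?thesis
    by eventually_elim (auto intro!: averages_tendsto_geometric nonneg)
qed

section \<open>Orlicz functions and norms\<close>

text \<open>The point \<open>(\<bar>y\<bar> + r) / b\<close> is the convex combination of
  \<open>\<bar>y\<bar> / a\<close> and \<open>r / (b - a)\<close> with weights \<open>a / b\<close>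
  and \<open>1 - a / b\<close>: enlarging the scale from \<open>a\<close> to \<open>b\<close> makes
  room for the shift \<open>r\<close>.\<close>

lemma orlicz_function_convex_bound:
  assumes \<psi>: "orlicz_function \<psi>" and ab: "0 < a" "a < b" and le: "\<bar>x\<bar> \<le> \<bar>y\<bar> + r" and "0 \<le> r"
  shows "\<psi> (\<bar>x\<bar> / b) \<le> (a / b) * \<psi> (\<bar>y\<bar> / a) + (1 - a / b) * \<psi> (r / (b - a))"
proof -
  have mono: "mono_on {0..} \<psi>" and conv: "convex_on {0..} \<psi>"
    using \<psi> by (auto simp: orlicz_function_def)
  define t where "t = 1 - a / b"
  have t: "0 \<le> t" "t \<le> 1" using ab by (auto simp: t_def)
  have eq: "(1 - t) * (\<bar>y\<bar> / a) + t * (r / (b - a)) = (\<bar>y\<bar> + r) / b"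
  proof -
    have "t = (b - a) / b" using ab by (simp add: t_def field_simps)
    then have "t * (r / (b - a)) = r / b" using ab by simp
    moreover have "(1 - t) * (\<bar>y\<bar> / a) = \<bar>y\<bar> / b" using ab by (simp add: t_def)
    ultimately show ?thesis by (simp add: add_divide_distrib)
  qed
  have "\<bar>x\<bar> / b \<le> (\<bar>y\<bar> + r) / b" using le ab by (simp add: divide_right_mono)
  then have "\<psi> (\<bar>x\<bar> / b) \<le> \<psi> ((1 - t) * (\<bar>y\<bar> / a) + t * (r / (b - a)))"
    unfolding eq using ab \<open>0 \<le> r\<close> by (intro mono_onD[OF mono]) auto
  also have "\<dots> \<le> (1 - t) * \<psi> (\<bar>y\<bar> / a) + t * \<psi> (r / (b - a))"
    using convex_onD[OF conv, of t "\<bar>y\<bar> / a" "r / (b - a)"] t ab \<open>0 \<le> r\<close> by simp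
  finally show ?thesis by (simp add: t_def)
qed

lemma orlicz_function_nonneg: "orlicz_function \<psi> \<Longrightarrow> 0 \<le> x \<Longrightarrow> 0 \<le> \<psi> x"
  by (simp add: orlicz_function_def)

lemma orlicz_function_mono:
  assumes "orlicz_function \<psi>" "0 \<le> x" "x \<le> y"
  shows "\<psi> x \<le> \<psi> y"
proof -
  have "mono_on {0..} \<psi>" using assms(1) by (simp add: orlicz_function_def)
  from mono_onD[OF this] show ?thesis using assms(2,3) by simp
qed

text \<open>Convexity and \<open>\<psi> 0 = 0\<close> give
  \<open>\<psi> t \<le> t * \<psi> 1\<close> on the unit interval. The \<open>+ 1\<close> in the
  witness keeps the denominator positive and the final inequality strict. The value \<open>t\<close>
  later fixes which moves of the signal count as small.\<close>

lemma orlicz_function_small_value: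
  assumes \<psi>: "orlicz_function \<psi>" and "0 < e"
  obtains t where "0 < t" "\<psi> t < e"
proof
  define t where "t = min 1 (e / (\<psi> 1 + 1))"
  have 1: "0 \<le> \<psi> 1" using \<psi> by (simp add: orlicz_function_nonneg)
  show "0 < t" using 1 \<open>0 < e\<close> by (simp add: t_def)
  have conv: "convex_on {0..} \<psi>" and "\<psi> 0 = 0" using \<psi> by (auto simp: orlicz_function_def)
  have "t \<le> 1" by (simp add: t_def)
  then have "\<psi> t \<le> t * \<psi> 1"
    using convex_onD[OF conv, of t 0 1] \<open>0 < t\<close> \<open>\<psi> 0 = 0\<close> by simp
  also have "\<dots> \<le> e / (\<psi> 1 + 1) * \<psi> 1"
    using 1 by (intro mult_right_mono) (auto simp: t_def)
  also have "\<dots> < e / (\<psi> 1 + 1) * (\<psi> 1 + 1)"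
    using 1 \<open>0 < e\<close> by (intro mult_strict_left_mono) auto
  also have "\<dots> = e" using 1 by simp
  finally show "\<psi> t < e" .
qed

text \<open>Since \<open>\<psi>\<close> is monotone only on the nonnegative half-line, it is first
  extended to a monotone, hence measurable, function by \<open>max 0\<close>; the extension agrees
  with \<open>\<psi>\<close> at the arguments that occur.\<close>

lemma borel_measurable_orlicz_function:
  assumes \<psi>: "orlicz_function \<psi>" and "0 < a"
  shows "(\<lambda>x. \<psi> (\<bar>x\<bar> / a)) \<in> borel_measurable borel"
proof -
  have "mono (\<lambda>x. \<psi> (max 0 x))"
    by (intro monoI orlicz_function_mono[OF \<psi>]) auto
  then have [measurable]: "(\<lambda>x. \<psi> (max 0 x)) \<in> borel_measurable borel"
    by (rule borel_measurable_mono)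
  have "(\<lambda>x. \<psi> (max 0 (\<bar>x\<bar> / a))) \<in> borel_measurable borel" by measurable
  moreover have "max 0 (\<bar>x\<bar> / a) = \<bar>x\<bar> / a" for x
    using \<open>0 < a\<close> by (intro max_absorb2) simp
  ultimately show ?thesis by simp
qed

lemma nn_integral_le_1_if_orlicz_norm_less:
  assumes \<psi>: "orlicz_function \<psi>" and less: "orlicz_norm M \<psi> X < ennreal a"
  shows "(\<integral>\<^sup>+ \<omega>. ennreal (\<psi> (\<bar>X \<omega>\<bar> / a)) \<partial>M) \<le> 1"
proof -
  obtain s where s: "0 < s" "(\<integral>\<^sup>+ \<omega>. ennreal (\<psi> (\<bar>X \<omega>\<bar> / s)) \<partial>M) \<le> 1" "ennreal s < ennreal a"
    using less by (auto simp: orlicz_norm_def Inf_less_iff)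
  then have "s < a" by (simp add: ennreal_less_iff)
  then have "(\<integral>\<^sup>+ \<omega>. ennreal (\<psi> (\<bar>X \<omega>\<bar> / a)) \<partial>M) \<le> (\<integral>\<^sup>+ \<omega>. ennreal (\<psi> (\<bar>X \<omega>\<bar> / s)) \<partial>M)"
    using s by (intro nn_integral_mono ennreal_leI orlicz_function_mono[OF \<psi>] frac_le) auto
  with s show ?thesis by simp
qed

lemma nn_integral_gr_1_if_less_orlicz_norm:
  assumes "0 < a" "ennreal a < orlicz_norm M \<psi> X"
  shows "1 < (\<integral>\<^sup>+ \<omega>. ennreal (\<psi> (\<bar>X \<omega>\<bar> / a)) \<partial>M)"
proof (rule ccontr)
  assume "\<not> ?thesis"
  then have "orlicz_norm M \<psi> X \<le> ennreal a"
    unfolding orlicz_norm_def using \<open>0 < a\<close> by (intro Inf_lower CollectI exI[of _ a]) (simp add: not_less)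
  with assms show False by simp
qed

section \<open>Averages over increments of a perturbed sequence\<close>

text \<open>A general \<open>g\<close> covers both \<open>\<psi>\<close> at a given scale and its
  truncations \<open>min \<psi> A\<close>.\<close>

definition diff_average :: "(real \<Rightarrow> real) \<Rightarrow> (nat \<Rightarrow> real) \<Rightarrow> nat \<Rightarrow> real" where
  "diff_average g y n = 1 / (real n - 1) * (\<Sum>i=2..n. g (y i - y (i - 1)))"

lemma diff_estimator_le:
  assumes "0 < s" "diff_average (\<lambda>x. \<psi> (\<bar>x\<bar> / s)) y n \<le> 1"
  shows "diff_estimator \<psi> n y \<le> ennreal s"
  unfolding diff_estimator_def
  by (intro Inf_lower CollectI exI[of _ s] conjI refl assms(1) assms(2)[unfolded diff_average_def])

lemma diff_estimator_ge:
  assumes \<psi>: "orlicz_function \<psi>" and "2 \<le> n" and "1 < diff_average (\<lambda>x. \<psi> (\<bar>x\<bar> / s)) y n"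
  shows "ennreal s \<le> diff_estimator \<psi> n y"
  unfolding diff_estimator_def
proof (rule Inf_greatest, clarify)
  fix t assume t: "0 < t" "1 / (real n - 1) * (\<Sum>i=2..n. \<psi> (\<bar>y i - y (i - 1)\<bar> / t)) \<le> 1"
  show "ennreal s \<le> ennreal t"
  proof (rule ccontr)
    assume "\<not> ennreal s \<le> ennreal t"
    then have "t < s" using t by (simp add: ennreal_less_iff not_le)
    have le: "\<psi> (\<bar>x\<bar> / s) \<le> \<psi> (\<bar>x\<bar> / t)" for x
      using t \<open>t < s\<close> by (intro orlicz_function_mono[OF \<psi>] frac_le) auto
    have "diff_average (\<lambda>x. \<psi> (\<bar>x\<bar> / s)) y n \<le> diff_average (\<lambda>x. \<psi> (\<bar>x\<bar> / t)) y n"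
      unfolding diff_average_def using \<open>2 \<le> n\<close>
      by (intro mult_left_mono[OF sum_mono] le) auto
    with t assms(3) show False by (simp add: diff_average_def)
  qed
qed

text \<open>The penalty \<open>\<eta>\<close> of a small move may be paid at every index and
  survives the averaging; the penalty \<open>B\<close> of a large move is paid at most
  \<open>K\<close> times, and its share is divided by \<open>n - 1\<close>. Either of
  \<open>x\<close> and \<open>y\<close> can be the errors, the other being the observations, which
  yields bounds in both directions.\<close>

lemma diff_average_jump_bound:
  assumes le: "\<And>i. 2 \<le> i \<Longrightarrow> i \<le> n \<Longrightarrow>
      f (x i - x (i - 1)) \<le> g (y i - y (i - 1)) + (if \<bar>m i - m (i - 1)\<bar> > r then B else \<eta>)"
    and "0 \<le> B" "0 \<le> \<eta>" "2 \<le> n"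
    and K: "jump_count n m r \<le> K"
  shows "diff_average f x n \<le> diff_average g y n + \<eta> + B * real K / (real n - 1)"
proof -
  have "(\<Sum>i=2..n. if \<bar>m i - m (i - 1)\<bar> > r then B else \<eta>)
      \<le> (\<Sum>i=2..n. \<eta> + B * real (if \<bar>m i - m (i - 1)\<bar> > r then 1 else 0))"
    using \<open>0 \<le> B\<close> \<open>0 \<le> \<eta>\<close> by (intro sum_mono) auto
  also have "\<dots> = (real n - 1) * \<eta> + B * real (jump_count n m r)"
    using \<open>2 \<le> n\<close> unfolding jump_count_def of_nat_sum sum.distrib sum_distrib_left[symmetric]
    by (simp add: of_nat_diff)
  also have "\<dots> \<le> (real n - 1) * \<eta> + B * real K"
    using K \<open>0 \<le> B\<close> by (intro add_left_mono mult_left_mono) auto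
  finally have penalty: "(\<Sum>i=2..n. if \<bar>m i - m (i - 1)\<bar> > r then B else \<eta>) \<le> (real n - 1) * \<eta> + B * real K" .
  have "(\<Sum>i=2..n. f (x i - x (i - 1)))
      \<le> (\<Sum>i=2..n. g (y i - y (i - 1)) + (if \<bar>m i - m (i - 1)\<bar> > r then B else \<eta>))"
    by (intro sum_mono le) auto
  also have "\<dots> \<le> (\<Sum>i=2..n. g (y i - y (i - 1))) + ((real n - 1) * \<eta> + B * real K)"
    using penalty unfolding sum.distrib by linarith
  finally have "(\<Sum>i=2..n. f (x i - x (i - 1))) \<le>
      (\<Sum>i=2..n. g (y i - y (i - 1))) + ((real n - 1) * \<eta> + B * real K)" .
  then have "(\<Sum>i=2..n. f (x i - x (i - 1))) / (real n - 1) \<le>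
      ((\<Sum>i=2..n. g (y i - y (i - 1))) + ((real n - 1) * \<eta> + B * real K)) / (real n - 1)"
    using \<open>2 \<le> n\<close> by (intro divide_right_mono) auto
  also have "\<dots> = (\<Sum>i=2..n. g (y i - y (i - 1))) / (real n - 1) + \<eta> + B * real K / (real n - 1)"
    using \<open>2 \<le> n\<close> by (simp add: add_divide_distrib)
  finally show ?thesis by (simp add: diff_average_def)
qed

text \<open>With \<open>c = a / b\<close>, passing to the larger scale multiplies the average of the
  errors by \<open>c\<close>, and the slack \<open>1 - c\<close> exceeds the penalty
  \<open>\<eta> = (1 - c) * \<psi> t\<close> of the small moves. The bound \<open>R\<close> on all
  moves makes the penalty \<open>B\<close> of a large one independent of \<open>n\<close>.\<close>

lemma eventually_diff_average_le_1:
  assumes \<psi>: "orlicz_function \<psi>" and ab: "0 < a" "a < b"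
    and lim: "(\<lambda>n. diff_average (\<lambda>x. \<psi> (\<bar>x\<bar> / a)) x n) \<longlonglongrightarrow> L" and "L \<le> 1"
    and y: "\<And>n i. 1 \<le> i \<Longrightarrow> i \<le> n \<Longrightarrow> y n i = m n i + x i"
    and jumps: "\<And>r. 0 < r \<Longrightarrow> \<exists>K. \<forall>\<^sub>F n in sequentially. jump_count n (m n) r \<le> K"
    and R: "0 \<le> R" "\<forall>\<^sub>F n in sequentially. \<forall>i\<in>{2..n}. \<bar>m n i - m n (i - 1)\<bar> \<le> R"
  shows "\<forall>\<^sub>F n in sequentially. diff_average (\<lambda>x. \<psi> (\<bar>x\<bar> / b)) (y n) n \<le> 1"
proof -
  define c where "c = a / b"
  have c: "0 < c" "c < 1" using ab by (auto simp: c_def)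
  obtain t where t: "0 < t" "\<psi> t < 1" using orlicz_function_small_value[OF \<psi>, of 1] by auto
  \<comment> \<open>The threshold for a small move is chosen so that the rescaled shift
    \<open>r / (b - a)\<close> in the convexity bound equals \<open>t\<close>.\<close>
  define r where "r = t * (b - a)"
  have r: "0 < r" "r / (b - a) = t" using t ab by (auto simp: r_def)
  obtain K where K: "\<forall>\<^sub>F n in sequentially. jump_count n (m n) r \<le> K"
    using jumps[OF r(1)] by blast
  define B where "B = (1 - c) * \<psi> (R / (b - a))"
  define \<eta> where "\<eta> = (1 - c) * \<psi> t"
  have B: "0 \<le> B" "0 \<le> \<eta>"
    using c R ab t by (auto simp: B_def \<eta>_def intro!: mult_nonneg_nonneg orlicz_function_nonneg[OF \<psi>])
  have "(\<lambda>n. c * diff_average (\<lambda>x. \<psi> (\<bar>x\<bar> / a)) x n + \<eta> + B * real K / (real n - 1)) \<longlonglongrightarrow> c * L + \<eta> + 0"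
    by (intro tendsto_intros lim) real_asymp
  moreover have "c * L + \<eta> + 0 < 1"
  proof -
    have "c * L \<le> c" using c \<open>L \<le> 1\<close> by simp
    moreover have "\<eta> < 1 - c" using c t by (simp add: \<eta>_def)
    ultimately show ?thesis by simp
  qed
  ultimately have "\<forall>\<^sub>F n in sequentially.
      c * diff_average (\<lambda>x. \<psi> (\<bar>x\<bar> / a)) x n + \<eta> + B * real K / (real n - 1) < 1"
    by (rule order_tendstoD)
  then show ?thesis
    using K R(2) eventually_ge_at_top[of 2]
  proof eventually_elim
    case (elim n)
    have "diff_average (\<lambda>x. \<psi> (\<bar>x\<bar> / b)) (y n) n
        \<le> diff_average (\<lambda>x. c * \<psi> (\<bar>x\<bar> / a)) x n + \<eta> + B * real K / (real n - 1)"
    proof (rule diff_average_jump_bound[where m = "m n" and r = r])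
      fix i assume i: "2 \<le> i" "i \<le> n"
      define \<delta> where "\<delta> = m n i - m n (i - 1)"
      have eq: "y n i - y n (i - 1) = x i - x (i - 1) + \<delta>"
        using i y[of i n] y[of "i - 1" n] by (simp add: \<delta>_def)
      have "\<bar>y n i - y n (i - 1)\<bar> \<le> \<bar>x i - x (i - 1)\<bar> + (if \<bar>\<delta>\<bar> > r then R else r)"
      proof -
        have "\<bar>\<delta>\<bar> \<le> R" using elim(3) i by (simp add: \<delta>_def)
        then show ?thesis
          unfolding eq using abs_triangle_ineq[of "x i - x (i - 1)" \<delta>] by (simp only: not_less split: if_split) linarith
      qed
      from orlicz_function_convex_bound[OF \<psi> ab this]
      show "\<psi> (\<bar>y n i - y n (i - 1)\<bar> / b) \<le> c * \<psi> (\<bar>x i - x (i - 1)\<bar> / a) +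
              (if \<bar>m n i - m n (i - 1)\<bar> > r then B else \<eta>)"
        using r R(1) by (cases "\<bar>\<delta>\<bar> > r") (simp_all add: c_def B_def \<eta>_def \<delta>_def)
    qed (use B elim(2,4) in simp_all)
    also have "diff_average (\<lambda>x. c * \<psi> (\<bar>x\<bar> / a)) x n = c * diff_average (\<lambda>x. \<psi> (\<bar>x\<bar> / a)) x n"
      by (simp add: diff_average_def sum_distrib_left[symmetric])
    finally show ?case using elim by simp
  qed
qed

text \<open>The roles are exchanged: the errors at the larger scale \<open>b\<close> are bounded by
  the observations at the smaller scale \<open>a\<close>. The cap \<open>A\<close> is itself the
  penalty at a large move, and at a small move the penalty \<open>\<psi> t\<close> stays below the
  margin \<open>L - 1\<close>.\<close>

lemma eventually_diff_average_gr_1: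
  assumes \<psi>: "orlicz_function \<psi>" and ab: "0 < a" "a < b" and "0 \<le> A"
    and lim: "(\<lambda>n. diff_average (\<lambda>x. min (\<psi> (\<bar>x\<bar> / b)) A) x n) \<longlonglongrightarrow> L" and "1 < L"
    and y: "\<And>n i. 1 \<le> i \<Longrightarrow> i \<le> n \<Longrightarrow> y n i = m n i + x i"
    and jumps: "\<And>r. 0 < r \<Longrightarrow> \<exists>K. \<forall>\<^sub>F n in sequentially. jump_count n (m n) r \<le> K"
  shows "\<forall>\<^sub>F n in sequentially. 1 < diff_average (\<lambda>x. \<psi> (\<bar>x\<bar> / a)) (y n) n"
proof -
  obtain t where t: "0 < t" "\<psi> t < L - 1"
    using orlicz_function_small_value[OF \<psi>, of "L - 1"] \<open>1 < L\<close> by auto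
  define r where "r = t * (b - a)"
  have r: "0 < r" "r / (b - a) = t" using t ab by (auto simp: r_def)
  obtain K where K: "\<forall>\<^sub>F n in sequentially. jump_count n (m n) r \<le> K"
    using jumps[OF r(1)] by blast
  have "(\<lambda>n. diff_average (\<lambda>x. min (\<psi> (\<bar>x\<bar> / b)) A) x n - \<psi> t - A * real K / (real n - 1)) \<longlonglongrightarrow> L - \<psi> t - 0"
    by (intro tendsto_intros lim) real_asymp
  moreover have "1 < L - \<psi> t - 0" using t by simp
  ultimately have "\<forall>\<^sub>F n in sequentially.
      1 < diff_average (\<lambda>x. min (\<psi> (\<bar>x\<bar> / b)) A) x n - \<psi> t - A * real K / (real n - 1)"
    by (rule order_tendstoD)
  then show ?thesis
    using K eventually_ge_at_top[of 2]
  proof eventually_elim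
    case (elim n)
    have nn: "0 \<le> \<psi> t" "0 \<le> \<psi> (\<bar>z\<bar> / a)" for z
      using t ab by (auto intro!: orlicz_function_nonneg[OF \<psi>])
    have "diff_average (\<lambda>x. min (\<psi> (\<bar>x\<bar> / b)) A) x n
        \<le> diff_average (\<lambda>x. \<psi> (\<bar>x\<bar> / a)) (y n) n + \<psi> t + A * real K / (real n - 1)"
    proof (rule diff_average_jump_bound[where m = "m n" and r = r])
      fix i assume i: "2 \<le> i" "i \<le> n"
      define \<delta> where "\<delta> = m n i - m n (i - 1)"
      define d w where "d = x i - x (i - 1)" and "w = y n i - y n (i - 1)"
      have eq: "w = d + \<delta>"
        using i y[of i n] y[of "i - 1" n] by (simp add: \<delta>_def d_def w_def)
      have "min (\<psi> (\<bar>d\<bar> / b)) A \<le> \<psi> (\<bar>w\<bar> / a) + (if \<bar>\<delta>\<bar> > r then A else \<psi> t)"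
      proof (cases "\<bar>\<delta>\<bar> > r")
        case True
        then show ?thesis using nn(2)[of w] by auto
      next
        case False
        then have "\<bar>d\<bar> \<le> \<bar>w\<bar> + r" unfolding eq by auto
        then have "\<psi> (\<bar>d\<bar> / b) \<le> (a / b) * \<psi> (\<bar>w\<bar> / a) + (1 - a / b) * \<psi> (r / (b - a))"
          using r by (intro orlicz_function_convex_bound[OF \<psi> ab]) auto
        also have "\<dots> \<le> 1 * \<psi> (\<bar>w\<bar> / a) + 1 * \<psi> (r / (b - a))"
          using ab nn r by (intro add_mono mult_right_mono) auto
        finally show ?thesis using False r by simp
      qed
      then show "min (\<psi> (\<bar>x i - x (i - 1)\<bar> / b)) A \<le> \<psi> (\<bar>y n i - y n (i - 1)\<bar> / a) +
              (if \<bar>m n i - m n (i - 1)\<bar> > r then A else \<psi> t)"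
        by (simp add: d_def w_def \<delta>_def)
    qed (use nn(1) elim(2,3) \<open>0 \<le> A\<close> in simp_all)
    then show ?case using elim by simp
  qed
qed

section \<open>Jump counts, truncated expectations, and the law for differences of errors\<close>

lemma eventually_jump_count_le:
  assumes "limsup (\<lambda>n. ereal (real (jump_count n (m n) r))) < ereal (real (Suc K))"
  shows "\<forall>\<^sub>F n in sequentially. jump_count n (m n) r \<le> K"
proof -
  have "\<forall>\<^sub>F n in sequentially. ereal (real (jump_count n (m n) r)) < ereal (real (Suc K))"
    using assms by (rule Limsup_lessD)
  then show ?thesis by eventually_elim simp
qed

lemma jump_count_eq_0_iff: "jump_count n m r = 0 \<longleftrightarrow> (\<forall>i\<in>{2..n}. \<bar>m i - m (i - 1)\<bar> \<le> r)"
  by (auto simp: jump_count_def not_less split: if_splits)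

text \<open>Monotone convergence in the cap \<open>A\<close>. It replaces a possibly infinite
  integral by a finite expectation, to which the strong law applies.\<close>

lemma expectation_truncation_gr:
  assumes "prob_space M" and [measurable]: "f \<in> borel_measurable M"
    and nonneg: "\<And>\<omega>. 0 \<le> f \<omega>" and gr: "ennreal c < (\<integral>\<^sup>+ \<omega>. ennreal (f \<omega>) \<partial>M)" and "0 \<le> c"
  shows "\<exists>A::nat. c < (\<integral> \<omega>. min (f \<omega>) (real A) \<partial>M)"
proof -
  interpret prob_space M by fact
  have "(\<integral>\<^sup>+ \<omega>. ennreal (f \<omega>) \<partial>M) = (\<integral>\<^sup>+ \<omega>. (SUP A. ennreal (min (f \<omega>) (real A))) \<partial>M)"
  proof (rule nn_integral_cong)
    fix \<omega>
    obtain A :: nat where "f \<omega> \<le> real A" using real_arch_simple by blast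
    then have "ennreal (f \<omega>) \<le> (SUP A. ennreal (min (f \<omega>) (real A)))"
      by (intro SUP_upper2[of A]) auto
    moreover have "(SUP A. ennreal (min (f \<omega>) (real A))) \<le> ennreal (f \<omega>)"
      by (intro SUP_least ennreal_leI) auto
    ultimately show "ennreal (f \<omega>) = (SUP A. ennreal (min (f \<omega>) (real A)))" by (rule antisym)
  qed
  also have "\<dots> = (SUP A. \<integral>\<^sup>+ \<omega>. ennreal (min (f \<omega>) (real A)) \<partial>M)"
    by (intro nn_integral_monotone_convergence_SUP)
       (auto simp: incseq_def le_fun_def intro!: ennreal_leI)
  finally obtain A :: nat where A: "ennreal c < (\<integral>\<^sup>+ \<omega>. ennreal (min (f \<omega>) (real A)) \<partial>M)"
    using gr by (auto simp: less_SUP_iff)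
  have "integrable M (\<lambda>\<omega>. min (f \<omega>) (real A))"
    by (rule integrable_const_bound[where B = "real A"]) (use nonneg in auto)
  then have "(\<integral>\<^sup>+ \<omega>. ennreal (min (f \<omega>) (real A)) \<partial>M) = ennreal (\<integral> \<omega>. min (f \<omega>) (real A) \<partial>M)"
    by (rule nn_integral_eq_integral) (use nonneg in auto)
  with A \<open>0 \<le> c\<close> show ?thesis by (auto simp: ennreal_less_iff)
qed

text \<open>Differences whose indices are at least two apart involve disjoint pairs of variables, so
  the gap is \<open>d = 2\<close>. All have the same law, the image of
  \<open>N \<Otimes>\<^sub>M N\<close> under one fixed map.\<close>

theorem (in prob_space) strong_law_differences:
  fixes X :: "nat \<Rightarrow> 'a \<Rightarrow> real" and g :: "real \<Rightarrow> real"
  assumes indep: "indep_vars (\<lambda>_. borel) X {1..}"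
    and ident: "\<And>i. 1 \<le> i \<Longrightarrow> distr M borel (X i) = N"
    and g [measurable]: "g \<in> borel_measurable borel" and nonneg: "\<And>x. 0 \<le> g x"
    and int: "integrable M (\<lambda>\<omega>. g (X 2 \<omega> - X 1 \<omega>))"
  shows "AE \<omega> in M. (\<lambda>n. diff_average g (\<lambda>i. X i \<omega>) n) \<longlonglongrightarrow> expectation (\<lambda>\<omega>. g (X 2 \<omega> - X 1 \<omega>))"
proof -
  define Z where "Z j \<omega> = g (X (j + 2) \<omega> - X (j + 1) \<omega>)" for j \<omega>
  have X_m [measurable]: "random_variable borel (X i)" if "1 \<le> i" for i
    using indep that by (auto simp: indep_vars_def)
  have X_m' [measurable]: "random_variable borel (X (Suc i))" for i
    by (rule X_m) simp
  have Z_m: "random_variable borel (Z j)" for j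
    unfolding Z_def by simp
  have restrict_indep: "indep_var (PiM A (\<lambda>_. borel)) (\<lambda>\<omega>. \<lambda>i\<in>A. X i \<omega>) (PiM B (\<lambda>_. borel)) (\<lambda>\<omega>. \<lambda>i\<in>B. X i \<omega>)"
    if "A \<inter> B = {}" "A \<subseteq> {1..}" "B \<subseteq> {1..}" for A B
    by (rule indep_var_restrict[OF indep that])
  have Z_indep: "indep_var borel (Z i) borel (Z j)" if "i + 2 \<le> j" for i j
  proof -
    define h where "h k f = g (f (k + 2) - f (k + 1))" for k and f :: "nat \<Rightarrow> real"
    have h: "h k \<in> borel_measurable (PiM {k + 1, k + 2} (\<lambda>_. borel))" for k
      unfolding h_def by measurable
    have comp: "h k \<circ> (\<lambda>\<omega>. \<lambda>i\<in>{k + 1, k + 2}. X i \<omega>) = Z k" for k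
      by (auto simp: h_def Z_def)
    have "indep_var borel (h i \<circ> (\<lambda>\<omega>. \<lambda>k\<in>{i + 1, i + 2}. X k \<omega>)) borel (h j \<circ> (\<lambda>\<omega>. \<lambda>k\<in>{j + 1, j + 2}. X k \<omega>))"
      by (intro indep_var_compose[OF restrict_indep h h]) (use that in auto)
    then show ?thesis by (simp only: comp)
  qed
  have Z_distr: "distr M borel (Z j) = distr (N \<Otimes>\<^sub>M N) borel (\<lambda>(x, y). g (y - x))" for j
  proof -
    have "indep_var borel ((\<lambda>f. f (j + 1)) \<circ> (\<lambda>\<omega>. \<lambda>k\<in>{j + 1}. X k \<omega>)) borel ((\<lambda>f. f (j + 2)) \<circ> (\<lambda>\<omega>. \<lambda>k\<in>{j + 2}. X k \<omega>))"
      by (intro indep_var_compose[OF restrict_indep]) auto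
    then have "indep_var borel (X (j + 1)) borel (X (j + 2))"
      by (simp add: comp_def)
    then have pair: "distr M (borel \<Otimes>\<^sub>M borel) (\<lambda>\<omega>. (X (j + 1) \<omega>, X (j + 2) \<omega>)) = N \<Otimes>\<^sub>M N"
      unfolding indep_var_distribution_eq using ident[of "j + 1"] ident[of "j + 2"] by simp
    have "distr M borel (Z j) = distr (distr M (borel \<Otimes>\<^sub>M borel) (\<lambda>\<omega>. (X (j + 1) \<omega>, X (j + 2) \<omega>))) borel (\<lambda>(x, y). g (y - x))"
      by (subst distr_distr) (auto simp: comp_def Z_def [abs_def])
    then show ?thesis by (simp only: pair)
  qed
  have Z0: "Z 0 = (\<lambda>\<omega>. g (X 2 \<omega> - X 1 \<omega>))"
    by (simp add: Z_def fun_eq_iff numeral_2_eq_2)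
  have "AE \<omega> in M. (\<lambda>n. (\<Sum>j<n. Z j \<omega>) / real n) \<longlonglongrightarrow> expectation (Z 0)"
  proof (rule strong_law_gap_independent[where d = 2])
    show "distr M borel (Z i) = distr M borel (Z 0)" for i by (simp only: Z_distr)
    show "integrable M (Z 0)" unfolding Z0 by (rule int)
    show "0 \<le> Z i \<omega>" for i \<omega> by (simp add: Z_def nonneg)
  qed (fact Z_m Z_indep)+
  then show ?thesis
  proof eventually_elim
    case (elim \<omega>)
    \<comment> \<open>The first \<open>Suc n\<close> observations have \<open>n\<close> differences,
      and \<open>Z j\<close> is the one at index \<open>j + 2\<close>; the shift from
      \<open>n\<close> to \<open>Suc n\<close> does not affect the limit.\<close>
    have "diff_average g (\<lambda>i. X i \<omega>) (Suc n) = (\<Sum>j<n. Z j \<omega>) / real n" for n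
    proof -
      have sum_eq: "(\<Sum>j<n. Z j \<omega>) = (\<Sum>i=2..Suc n. g (X i \<omega> - X (i - 1) \<omega>))"
      proof (rule sum.reindex_bij_witness[of _ "\<lambda>i. i - 2" "\<lambda>j. j + 2"])
        fix i assume "i \<in> {2..Suc n}"
        then have "2 \<le> i" "i \<le> Suc n" by simp_all
        then show "i - 2 + 2 = i" "i - 2 \<in> {..<n}" by (simp_all only: le_add_diff_inverse2 lessThan_iff)
      qed (simp_all add: Z_def)
      show ?thesis unfolding diff_average_def sum_eq by simp
    qed
    then show ?case
      using elim unfolding Z0 by (subst filterlim_sequentially_Suc [symmetric]) simp
  qed
qed

section \<open>Almost sure convergence of the estimator\<close>

theorem theorem2p3:
  fixes M :: "'a measure"
    and \<psi> :: "real \<Rightarrow> real"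
    and \<epsilon>0 :: "'a \<Rightarrow> real"
    and \<epsilon> :: "nat \<Rightarrow> 'a \<Rightarrow> real"
    and \<mu> :: "nat \<Rightarrow> nat \<Rightarrow> real"
    and Y :: "nat \<Rightarrow> nat \<Rightarrow> 'a \<Rightarrow> real"
    and Estar :: "real \<Rightarrow> real"
  assumes "prob_space M"
    and "orlicz_function \<psi>"
    and "prob_space.indep_vars M (\<lambda>_. borel) \<epsilon> {1..}"
    and "\<epsilon>0 \<in> borel_measurable M"
    and "\<And>i. i \<ge> 1 \<Longrightarrow> distr M borel (\<epsilon> i) = distr M borel \<epsilon>0"
    and "integrable M \<epsilon>0" and "integral\<^sup>L M \<epsilon>0 = 0"
    and "\<And>n i \<omega>. 1 \<le> i \<Longrightarrow> i \<le> n \<Longrightarrow> \<omega> \<in> space M \<Longrightarrow> Y n i \<omega> = \<mu> n i + \<epsilon> i \<omega>"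
    and "orlicz_norm M \<psi> \<epsilon>0 < \<infinity>"
    and "\<And>r. r > 0 \<Longrightarrow> Estar r \<ge> 0"
    and "\<And>r. r > 0 \<Longrightarrow> limsup (\<lambda>n. ereal (real (jump_count n (\<mu> n) r))) \<le> ereal (Estar r)"
    and "(Estar \<longlongrightarrow> 0) at_top"
  shows "AE \<omega> in M. (\<lambda>n. diff_estimator \<psi> n (\<lambda>i. Y n i \<omega>))
           \<longlonglongrightarrow> orlicz_norm M \<psi> (\<lambda>\<omega>. \<epsilon> 2 \<omega> - \<epsilon> 1 \<omega>)"
proof -
  interpret prob_space M by fact
  note \<psi> = assms(2) and indep = assms(3) and ident = assms(5) and Y = assms(8) and limsup_le = assms(11)
  define s where "s = orlicz_norm M \<psi> (\<lambda>\<omega>. \<epsilon> 2 \<omega> - \<epsilon> 1 \<omega>)"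
  have jumps: "\<exists>K. \<forall>\<^sub>F n in sequentially. jump_count n (\<mu> n) r \<le> K" if "0 < r" for r
  proof -
    obtain K :: nat where "Estar r \<le> real K" using real_arch_simple by blast
    then have "ereal (Estar r) < ereal (real (Suc K))" by simp
    from eventually_jump_count_le[OF le_less_trans[OF limsup_le[OF that] this]] show ?thesis by blast
  qed
  \<comment> \<open>Some \<open>R\<close> has \<open>Estar R < 1\<close>. Counts are integers, so
    the number of moves above \<open>R\<close> is eventually zero.\<close>
  obtain R where R: "0 \<le> R" "\<forall>\<^sub>F n in sequentially. \<forall>i\<in>{2..n}. \<bar>\<mu> n i - \<mu> n (i - 1)\<bar> \<le> R"
  proof -
    have "\<forall>\<^sub>F r in at_top. Estar r < 1"
      using assms(12) by (rule order_tendstoD) simp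
    then have "\<forall>\<^sub>F r in at_top. Estar r < 1 \<and> 0 < r"
      using eventually_gt_at_top[of 0] by (rule eventually_conj)
    then obtain R where R: "Estar R < 1" "0 < R"
      using eventually_happens'[OF trivial_limit_at_top_linorder] by blast
    then have "ereal (Estar R) < ereal (real (Suc 0))" by simp
    from eventually_jump_count_le[OF le_less_trans[OF limsup_le[OF R(2)] this]]
    have "\<forall>\<^sub>F n in sequentially. \<forall>i\<in>{2..n}. \<bar>\<mu> n i - \<mu> n (i - 1)\<bar> \<le> R"
      by (simp only: le_zero_eq jump_count_eq_0_iff)
    with R show ?thesis by (intro that[of R]) auto
  qed
  have \<epsilon>_m [measurable]: "random_variable borel (\<epsilon> i)" if "1 \<le> i" for i
    using indep that by (auto simp: indep_vars_def)
  have \<psi>_m [measurable]: "(\<lambda>x. \<psi> (\<bar>x\<bar> / q)) \<in> borel_measurable borel" if "0 < q" for q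
    using \<psi> that by (rule borel_measurable_orlicz_function)
  have \<psi>_nonneg: "0 \<le> \<psi> (\<bar>x\<bar> / q)" if "0 < q" for x q
    using that by (intro orlicz_function_nonneg[OF \<psi>]) auto
  have \<psi>_rv: "random_variable borel (\<lambda>\<omega>. \<psi> (\<bar>\<epsilon> 2 \<omega> - \<epsilon> 1 \<omega>\<bar> / q))" if "0 < q" for q
    by (rule measurable_compose[OF _ \<psi>_m[OF that]]) simp
  \<comment> \<open>These are properties of a single error path at scale \<open>q\<close>, for
    \<open>q\<close> above or below the limit \<open>s\<close>. Restricted to rational
    \<open>q\<close>, they hold together outside one null set; the rest of the argument is
    deterministic.\<close>
  define above where "above q \<omega> \<longleftrightarrow>
    (\<exists>L\<le>1. (\<lambda>n. diff_average (\<lambda>x. \<psi> (\<bar>x\<bar> / q)) (\<lambda>i. \<epsilon> i \<omega>) n) \<longlonglongrightarrow> L)" for q \<omega>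
  define below where "below q \<omega> \<longleftrightarrow>
    (\<exists>A\<ge>0. \<exists>L>1. (\<lambda>n. diff_average (\<lambda>x. min (\<psi> (\<bar>x\<bar> / q)) A) (\<lambda>i. \<epsilon> i \<omega>) n) \<longlonglongrightarrow> L)" for q \<omega>
  have AE_above: "AE \<omega> in M. above q \<omega>" if "0 < q" "s < ennreal q" for q
  proof -
    note rv = \<psi>_rv[OF that(1)] and nonneg = \<psi>_nonneg[OF that(1)]
    have le: "(\<integral>\<^sup>+ \<omega>. ennreal (\<psi> (\<bar>\<epsilon> 2 \<omega> - \<epsilon> 1 \<omega>\<bar> / q)) \<partial>M) \<le> 1"
      using nn_integral_le_1_if_orlicz_norm_less[OF \<psi>] that(2) by (simp add: s_def)
    have int: "integrable M (\<lambda>\<omega>. \<psi> (\<bar>\<epsilon> 2 \<omega> - \<epsilon> 1 \<omega>\<bar> / q))"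
      using rv le nonneg by (intro integrableI_nonneg) (auto intro: le_less_trans)
    then have "ennreal (expectation (\<lambda>\<omega>. \<psi> (\<bar>\<epsilon> 2 \<omega> - \<epsilon> 1 \<omega>\<bar> / q))) \<le> ennreal 1"
      using le nonneg by (subst (asm) nn_integral_eq_integral) auto
    then have "expectation (\<lambda>\<omega>. \<psi> (\<bar>\<epsilon> 2 \<omega> - \<epsilon> 1 \<omega>\<bar> / q)) \<le> 1"
      by (subst (asm) ennreal_le_iff) auto
    with strong_law_differences[OF indep ident \<psi>_m[OF that(1)] nonneg int]
    show ?thesis unfolding above_def by (rule_tac eventually_mono) auto
  qed
  have AE_below: "AE \<omega> in M. below q \<omega>" if "0 < q" "ennreal q < s" for q
  proof -
    note rv = \<psi>_rv[OF that(1)] and nonneg = \<psi>_nonneg[OF that(1)]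
    have gr: "ennreal 1 < (\<integral>\<^sup>+ \<omega>. ennreal (\<psi> (\<bar>\<epsilon> 2 \<omega> - \<epsilon> 1 \<omega>\<bar> / q)) \<partial>M)"
      using nn_integral_gr_1_if_less_orlicz_norm that by (simp add: s_def)
    obtain A :: nat where A: "1 < expectation (\<lambda>\<omega>. min (\<psi> (\<bar>\<epsilon> 2 \<omega> - \<epsilon> 1 \<omega>\<bar> / q)) (real A))"
      using expectation_truncation_gr[OF prob_space_axioms rv nonneg gr] by auto
    have int: "integrable M (\<lambda>\<omega>. min (\<psi> (\<bar>\<epsilon> 2 \<omega> - \<epsilon> 1 \<omega>\<bar> / q)) (real A))"
    proof (rule integrable_const_bound[where B = "real A"])
      show "random_variable borel (\<lambda>\<omega>. min (\<psi> (\<bar>\<epsilon> 2 \<omega> - \<epsilon> 1 \<omega>\<bar> / q)) (real A))"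
        by (intro borel_measurable_min rv) simp
    qed (use nonneg in auto)
    have m: "(\<lambda>x. min (\<psi> (\<bar>x\<bar> / q)) (real A)) \<in> borel_measurable borel"
      by (intro borel_measurable_min \<psi>_m that(1)) simp
    have nonneg': "0 \<le> min (\<psi> (\<bar>x\<bar> / q)) (real A)" for x
      using nonneg[of x] by simp
    have "AE \<omega> in M. (\<lambda>n. diff_average (\<lambda>x. min (\<psi> (\<bar>x\<bar> / q)) (real A)) (\<lambda>i. \<epsilon> i \<omega>) n) \<longlonglongrightarrow>
        expectation (\<lambda>\<omega>. min (\<psi> (\<bar>\<epsilon> 2 \<omega> - \<epsilon> 1 \<omega>\<bar> / q)) (real A))"
      by (rule strong_law_differences[OF indep ident m nonneg' int])
    then show ?thesis
    proof eventually_elim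
      case (elim \<omega>)
      show ?case
        unfolding below_def by (rule exI[of _ "real A"], rule conjI, simp, rule exI, rule conjI, rule A, rule elim)
    qed
  qed
  have "AE \<omega> in M. \<forall>q\<in>\<rat>. 0 < q \<longrightarrow> (s < ennreal q \<longrightarrow> above q \<omega>) \<and> (ennreal q < s \<longrightarrow> below q \<omega>)"
    using AE_above AE_below by (subst AE_ball_countable[OF countable_rat]) auto
  then show ?thesis
    unfolding s_def[symmetric] using AE_space
  proof eventually_elim
    case (elim \<omega>)
    have Y': "Y n i \<omega> = \<mu> n i + \<epsilon> i \<omega>" if "1 \<le> i" "i \<le> n" for n i
      using Y[OF that elim(2)] .
    \<comment> \<open>Two scales are required because the perturbation bounds pass from one scale to
      a strictly different one. The endpoints may be infinite, so finite values \<open>a\<close> and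
      \<open>b\<close> are inserted first; \<open>0 \<le> a\<close> makes the rationals
      positive.\<close>
    have between: "\<exists>q\<in>\<rat>. \<exists>q'\<in>\<rat>. x < ennreal q \<and> 0 < q \<and> q < q' \<and> ennreal q' < y"
      if xy: "x < y" for x y :: ennreal
    proof -
      obtain z where z: "x < z" "z < y" using dense[OF xy] by blast
      obtain z' where z': "z < z'" "z' < y" using dense[OF \<open>z < y\<close>] by blast
      obtain b where b: "0 \<le> b" "z' = ennreal b" using \<open>z' < y\<close> by (cases z') auto
      obtain a where a: "0 \<le> a" "z = ennreal a" using \<open>z < y\<close> by (cases z) auto
      have "a < b" using \<open>z < z'\<close> a b by (simp add: ennreal_less_iff)
      then obtain q where q: "q \<in> \<rat>" "a < q" "q < b" using Rats_dense_in_real by blast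
      obtain q' where q': "q' \<in> \<rat>" "q < q'" "q' < b" using Rats_dense_in_real[OF \<open>q < b\<close>] by blast
      have "ennreal a \<le> ennreal q" using q(2) by (intro ennreal_leI) simp
      with z(1) have "x < ennreal q" unfolding a(2) by (rule less_le_trans)
      moreover have "ennreal q' \<le> ennreal b" using q'(3) by (intro ennreal_leI) simp
      then have "ennreal q' < y" using z'(2) unfolding b(2) by (rule le_less_trans)
      moreover have "0 < q" using a(1) q(2) by simp
      ultimately show ?thesis using q(1) q'(1,2) by blast
    qed
    show ?case
    proof (rule order_tendstoI)
      fix x assume "x < s"
      from between[OF this] obtain q q' where
        q: "q \<in> \<rat>" "q' \<in> \<rat>" "x < ennreal q" "0 < q" "q < q'" "ennreal q' < s" by blast
      \<comment> \<open>The law for the errors is used at the larger scale \<open>q'\<close>, and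
        the smaller scale \<open>q\<close> becomes a lower bound for the estimator.\<close>
      have "0 < q'" using q(4,5) by simp
      then have "below q' \<omega>" using elim(1)[THEN bspec, OF q(2)] q(6) by simp
      then obtain A L where "0 \<le> A" "1 < L"
        "(\<lambda>n. diff_average (\<lambda>x. min (\<psi> (\<bar>x\<bar> / q')) A) (\<lambda>i. \<epsilon> i \<omega>) n) \<longlonglongrightarrow> L"
        by (auto simp: below_def)
      from eventually_diff_average_gr_1[OF \<psi> q(4,5) this(1,3,2) Y' jumps]
      have "\<forall>\<^sub>F n in sequentially. 1 < diff_average (\<lambda>x. \<psi> (\<bar>x\<bar> / q)) (\<lambda>i. Y n i \<omega>) n" .
      then show "\<forall>\<^sub>F n in sequentially. x < diff_estimator \<psi> n (\<lambda>i. Y n i \<omega>)"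
        using eventually_ge_at_top[of 2]
      proof eventually_elim
        case (elim n)
        from diff_estimator_ge[OF \<psi> elim(2,1)] q(3) show ?case by (rule less_le_trans[rotated])
      qed
    next
      fix x assume "s < x"
      from between[OF this] obtain q q' where
        q: "q \<in> \<rat>" "q' \<in> \<rat>" "s < ennreal q" "0 < q" "q < q'" "ennreal q' < x" by blast
      \<comment> \<open>Here the law is used at the smaller scale \<open>q\<close>, and
        \<open>q'\<close> becomes an upper bound for the estimator.\<close>
      then have "above q \<omega>" using elim(1)[THEN bspec, OF q(1)] by simp
      then obtain L where "L \<le> 1"
        "(\<lambda>n. diff_average (\<lambda>x. \<psi> (\<bar>x\<bar> / q)) (\<lambda>i. \<epsilon> i \<omega>) n) \<longlonglongrightarrow> L"
        by (auto simp: above_def)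
      from eventually_diff_average_le_1[OF \<psi> q(4,5) this(2,1) Y' jumps R]
      have "\<forall>\<^sub>F n in sequentially. diff_average (\<lambda>x. \<psi> (\<bar>x\<bar> / q')) (\<lambda>i. Y n i \<omega>) n \<le> 1" .
      then show "\<forall>\<^sub>F n in sequentially. diff_estimator \<psi> n (\<lambda>i. Y n i \<omega>) < x"
      proof eventually_elim
        case (elim n)
        have "diff_estimator \<psi> n (\<lambda>i. Y n i \<omega>) \<le> ennreal q'"
          using q elim by (intro diff_estimator_le) auto
        with q(6) show ?case by (rule le_less_trans[rotated])
      qed
    qed
  qed
qed

end
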